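(* Let $\mathcal{M}$ and $\mathcal{N}$ be two almost-moon polyominoes such that $\mathcal{N}$ is obtained from $\mathcal{M}$ by an interchange of two adjacent rows, and assume that neither $\mathcal{M}$ nor $\mathcal{N}$ has an exceptional row other than the two swapped rows. Then there are bijections $\phi_{\mathcal{M},\mathcal{N}}:\mathcal{F}(\mathcal{M})\to\mathcal{F}(\mathcal{N})$ and $\phi_{\mathcal{N},\mathcal{M}}:\mathcal{F}(\mathcal{N})\to\mathcal{F}(\mathcal{M})$, each of which preserves the column sums of the fillings and the statistic $\mathrm{ne}$ (i.e. $\mathrm{ne}(\phi_{\mathcal{M},\mathcal{N}}(M))=\mathrm{ne}(M)$ for all $M\in\mathcal{F}(\mathcal{M})$, and similarly for $\phi_{\mathcal{N},\mathcal{M}}$), and such that $\phi_{\mathcal{N},\mathcal{M}}\circ\phi_{\mathcal{M},\mathcal{N}}$ is the identity on $\mathcal{F}(\mathcal{M})$.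
   Context: A polyomino is a finite set of cells $(i,j)\in\mathbb{Z}^2$, where $i$ is the column (horizontal) coordinate and $j$ the row (vertical) coordinate; a row is the set of its cells with a fixed $j$, a column the set with a fixed $i$, and the length of a row/column is its number of cells. Two rows are comparable if the set of column coordinates of one contains that of the other. A row $\mathcal{R}$ of a polyomino is exceptional if there is a row above $\mathcal{R}$ and a row below $\mathcal{R}$, both of length larger than that of $\mathcal{R}$. An almost-moon polyomino is a polyomino whose rows are connected (convex) and pairwise comparable, and which has at most one exceptional row. Interchanging two adjacent rows means moving the cells of one row to the vertical position of the other and vice versa, keeping their column coordinates. A 01-filling assigns 0 or 1 to every cell. A northeast chain (ne-chain) of size $k$ in a 01-filling of a polyomino $\mathcal{P}$ is a set of $k$ cells $(i_1,j_1),\dots,(i_k,j_k)$ filled with 1, with $i_1<\dots<i_k$ and $j_1<\dots<j_k$, such that all cells $(i_r,j_s)$, $1\le r,s\le k$, belong to $\mathcal{P}$. For a filling $M$, $\mathrm{ne}(M)$ is the largest size of an ne-chain in $M$. $\mathcal{F}(\mathcal{P})$ denotes the set of all 01-fillings of $\mathcal{P}$; the column sums of a filling are the numbers of 1's in each column. *)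

theory Defs
  imports "HOL-Library.FuncSet" "HOL-Combinatorics.Transposition"
begin

type_synonym cell = "int \<times> int"

text \<open>
  A cell is a pair (column, row), and a polyomino is any finite set of cells. Only the non-empty
  horizontal slices count as rows, so a level without cells is never an exceptional row.
\<close>

definition row_cols :: "cell set \<Rightarrow> int \<Rightarrow> int set" where
  "row_cols P j = {i. (i, j) \<in> P}"

definition is_row :: "cell set \<Rightarrow> int \<Rightarrow> bool" where
  "is_row P j \<longleftrightarrow> row_cols P j \<noteq> {}"

definition row_length :: "cell set \<Rightarrow> int \<Rightarrow> nat" where
  "row_length P j = card (row_cols P j)"

definition row_convex :: "cell set \<Rightarrow> int \<Rightarrow> bool" where
  "row_convex P j \<longleftrightarrow> (\<forall>a\<in>row_cols P j. \<forall>b\<in>row_cols P j. {a..b} \<subseteq> row_cols P j)"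

definition comparable_rows :: "cell set \<Rightarrow> int \<Rightarrow> int \<Rightarrow> bool" where
  "comparable_rows P j l \<longleftrightarrow> row_cols P j \<subseteq> row_cols P l \<or> row_cols P l \<subseteq> row_cols P j"

definition exceptional_row :: "cell set \<Rightarrow> int \<Rightarrow> bool" where
  "exceptional_row P j \<longleftrightarrow> is_row P j \<and>
     (\<exists>u. is_row P u \<and> u > j \<and> row_length P u > row_length P j) \<and>
     (\<exists>d. is_row P d \<and> d < j \<and> row_length P d > row_length P j)"

definition almost_moon :: "cell set \<Rightarrow> bool" where
  "almost_moon P \<longleftrightarrow> finite P \<and>
     (\<forall>j. is_row P j \<longrightarrow> row_convex P j) \<and>
     (\<forall>j l. is_row P j \<longrightarrow> is_row P l \<longrightarrow> comparable_rows P j l) \<and>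
     (\<forall>j l. exceptional_row P j \<longrightarrow> exceptional_row P l \<longrightarrow> j = l)"

definition interchange_rows :: "int \<Rightarrow> int \<Rightarrow> cell set \<Rightarrow> cell set" where
  "interchange_rows j l P = (\<lambda>(i, r). (i, Transposition.transpose j l r)) ` P"

text \<open>
  Fillings are extensional functions (undefined outside the polyomino), so that distinct elements
  of \<open>fillings P\<close> differ on some cell of \<open>P\<close>.
\<close>

definition fillings :: "cell set \<Rightarrow> (cell \<Rightarrow> nat) set" where
  "fillings P = P \<rightarrow>\<^sub>E {0, 1}"

definition column_sum :: "cell set \<Rightarrow> (cell \<Rightarrow> nat) \<Rightarrow> int \<Rightarrow> nat" where
  "column_sum P f i = card {j. (i, j) \<in> P \<and> f (i, j) = 1}"

definition ne_chain :: "cell set \<Rightarrow> (cell \<Rightarrow> nat) \<Rightarrow> nat \<Rightarrow> cell set \<Rightarrow> bool" where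
  "ne_chain P f k C \<longleftrightarrow>
     (\<exists>i j :: nat \<Rightarrow> int.
        strict_mono_on {1..k} i \<and> strict_mono_on {1..k} j \<and>
        C = (\<lambda>r. (i r, j r)) ` {1..k} \<and>
        (\<forall>c\<in>C. f c = 1) \<and>
        (\<forall>r\<in>{1..k}. \<forall>s\<in>{1..k}. (i r, j s) \<in> P))"

text \<open>
  The empty chain is allowed, so the maximum is over a non-empty set and an all-zero filling has
  \<open>ne\<close> equal to 0; for finite polyominoes this set is also finite.
\<close>

definition ne :: "cell set \<Rightarrow> (cell \<Rightarrow> nat) \<Rightarrow> nat" where
  "ne P f = Max {k. \<exists>C. ne_chain P f k C}"

lemma ne_chain_card:
  assumes "ne_chain P f k C"
  shows "card C = k" and "C \<subseteq> P"
proof -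
  obtain i j where ij: "strict_mono_on {1..k} i" "C = (\<lambda>r. (i r, j r)) ` {1..k}"
    "\<forall>r\<in>{1..k}. \<forall>s\<in>{1..k}. (i r, j s) \<in> P"
    using assms unfolding ne_chain_def by blast
  have "inj_on (\<lambda>r. (i r, j r)) {1..k}"
    using strict_mono_on_imp_inj_on[OF ij(1)] unfolding inj_on_def prod.inject by blast
  then show "card C = k" using ij(2) by (simp add: card_image)
  show "C \<subseteq> P" unfolding ij(2) using ij(3) by blast
qed

lemma ne_chain_empty: "ne_chain P f 0 {}"
  by (simp add: ne_chain_def strict_mono_on_def)

lemma finite_ne_chain_sizes:
  assumes "finite P"
  shows "finite {k. \<exists>C. ne_chain P f k C}"
proof (rule finite_subset)
  show "{k. \<exists>C. ne_chain P f k C} \<subseteq> {..card P}"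
  proof
    fix k assume "k \<in> {k. \<exists>C. ne_chain P f k C}"
    then obtain C where C: "ne_chain P f k C" by blast
    have "card C \<le> card P" using card_mono[OF assms ne_chain_card(2)[OF C]] .
    then show "k \<in> {..card P}" using ne_chain_card(1)[OF C] by simp
  qed
qed simp

end

(* Both directions are equinumerosity statements: it suffices to show, for every k, that there are
   equally many fillings with given column sums and ne at most k. Of the two swapped rows let R be
   the shorter and L the longer one, and fix the other rows. Call a column x of R critical if some
   chain of size k in the other rows, living in a rectangle wider than R and at most as wide as L,
   becomes a chain of size k + 1 as soon as the cell of L in column x is filled. If ne is at most k,
   critical columns are empty in L. Now let critical columns and columns outside R move along with
   the rows, and let the two entries in the remaining columns of R stay at their levels. This map is
   injective, because criticality depends on the other rows only. A chain of size k + 1 in the image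
   either gives one in the source, or it meets both rows, in columns x < y of R. By uncrossing it
   with a chain that shows x or y to be critical, one sees that x is critical iff y is. So both
   columns are moved or both are kept, and each case is contradictory. *)

theory Submission
  imports Defs
begin

section \<open>Chains as sorted lists\<close>

definition ne_less :: "cell \<Rightarrow> cell \<Rightarrow> bool" where
  "ne_less c d \<longleftrightarrow> fst c < fst d \<and> snd c < snd d"

definition chain_list :: "cell set \<Rightarrow> (cell \<Rightarrow> nat) \<Rightarrow> cell list \<Rightarrow> bool" where
  "chain_list P f cs \<longleftrightarrow> sorted_wrt ne_less cs \<and> (\<forall>c\<in>set cs. f c = 1) \<and>
     (\<forall>c\<in>set cs. \<forall>d\<in>set cs. (fst c, snd d) \<in> P)"

text \<open>Lists allow chains to be cut at a cell and pieces to be joined or exchanged. Increasing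
  in both coordinates means sorted by \<open>ne_less\<close>; indices shift by one because chains
  are numbered from 1.\<close>

lemma ne_chain_iff_chain_list:
  "(\<exists>C. ne_chain P f k C) \<longleftrightarrow> (\<exists>cs. chain_list P f cs \<and> length cs = k)"
proof
  assume "\<exists>C. ne_chain P f k C"
  then obtain C and i j :: "nat \<Rightarrow> int" where
    i: "strict_mono_on {1..k} i" and j: "strict_mono_on {1..k} j" and
    C: "C = (\<lambda>r. (i r, j r)) ` {1..k}" "\<forall>c\<in>C. f c = 1" and
    P: "\<forall>r\<in>{1..k}. \<forall>s\<in>{1..k}. (i r, j s) \<in> P"
    unfolding ne_chain_def by (elim exE conjE) (rule that)
  have f: "f (i r, j r) = 1" if "r \<in> {1..k}" for r
    using C that by blast
  let ?cs = "map (\<lambda>r. (i r, j r)) [1..<Suc k]"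
  have "sorted_wrt ne_less ?cs"
    by (auto simp: sorted_wrt_iff_nth_less ne_less_def
        intro!: strict_mono_onD[OF i] strict_mono_onD[OF j] simp del: upt_Suc)
  then have "chain_list P f ?cs"
    using f P unfolding chain_list_def by auto
  then show "\<exists>cs. chain_list P f cs \<and> length cs = k"
    by (intro exI[of _ ?cs]) simp
next
  assume "\<exists>cs. chain_list P f cs \<and> length cs = k"
  then obtain cs where cs: "chain_list P f cs" and k: "length cs = k" by blast
  let ?c = "\<lambda>r. cs ! (r - 1)"
  have mem: "?c r \<in> set cs" if "r \<in> {1..k}" for r
    using that k by auto
  have less: "ne_less (?c r) (?c s)" if "r \<in> {1..k}" "s \<in> {1..k}" "r < s" for r s
    using that k cs by (auto simp: chain_list_def sorted_wrt_iff_nth_less)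
  have "strict_mono_on {1..k} (\<lambda>r. fst (?c r))" "strict_mono_on {1..k} (\<lambda>r. snd (?c r))"
    using less by (auto simp: ne_less_def strict_mono_on_def)
  moreover have "\<forall>c\<in>?c ` {1..k}. f c = 1"
    "\<forall>r\<in>{1..k}. \<forall>s\<in>{1..k}. (fst (?c r), snd (?c s)) \<in> P"
    using mem cs unfolding chain_list_def by auto
  ultimately have "ne_chain P f k (?c ` {1..k})"
    unfolding ne_chain_def
    by (intro exI[of _ "\<lambda>r. fst (?c r)"] exI[of _ "\<lambda>r. snd (?c r)"] conjI) simp_all
  then show "\<exists>C. ne_chain P f k C" by blast
qed

lemma ne_le_iff:
  assumes "finite P"
  shows "ne P f \<le> k \<longleftrightarrow> (\<forall>cs. chain_list P f cs \<longrightarrow> length cs \<le> k)"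
proof -
  have "ne P f \<le> k \<longleftrightarrow> (\<forall>m\<in>{m. \<exists>C. ne_chain P f m C}. m \<le> k)"
    unfolding ne_def using finite_ne_chain_sizes[OF assms] ne_chain_empty
    by (subst Max_le_iff) blast+
  then show ?thesis
    by (auto simp: ne_chain_iff_chain_list)
qed

section \<open>Uncrossing two chains\<close>

text \<open>
  Uncrossing: \<open>us\<close> lives in the narrow rectangle with columns \<open>Y\<close>, \<open>vs\<close> in the lower and wider
  rectangle with rows \<open>H\<close>. Unless \<open>vs\<close> already lies right of \<open>\<beta>\<close>, tails of the two chains are
  exchanged at a crossing, or the chains trade places because each fits into both rectangles.
\<close>

lemma exchange_above:
  assumes conv: "\<And>a b c. \<lbrakk>a \<in> Y; b \<in> Y; a < c; c \<le> b\<rbrakk> \<Longrightarrow> c \<in> Y"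
    and "sorted_wrt ne_less us" and "sorted_wrt ne_less vs"
    and "\<forall>c\<in>set us. \<beta> < fst c \<and> fst c \<in> Y \<and> (snd c \<in> H \<or> (\<forall>h\<in>H. h < snd c))"
    and "\<forall>c\<in>set vs. \<alpha> < fst c \<and> snd c \<in> H"
    and "\<alpha> \<le> \<beta>" and "\<alpha> \<in> Y" and "\<beta> \<in> Y"
  shows "\<exists>us' vs'. sorted_wrt ne_less us' \<and> sorted_wrt ne_less vs' \<and>
    set us' \<subseteq> set us \<union> set vs \<and> set vs' \<subseteq> set us \<union> set vs \<and>
    length us' + length vs' = length us + length vs \<and>
    (\<forall>c\<in>set us'. \<alpha> < fst c \<and> fst c \<in> Y) \<and> (\<forall>c\<in>set vs'. \<beta> < fst c \<and> snd c \<in> H)"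
    (is "\<exists>us' vs'. ?concl us vs \<alpha> \<beta> us' vs'")
  using assms(2-)
proof (induction "length us + length vs" arbitrary: us vs \<alpha> \<beta> rule: less_induct)
  case less
  let ?thesis = "\<exists>us' vs'. ?concl us vs \<alpha> \<beta> us' vs'"
  show ?case
  proof (cases "\<forall>c\<in>set vs. \<beta> < fst c")
    case True
    then have "?concl us vs \<alpha> \<beta> us vs"
      using less.prems by fastforce
    then show ?thesis by blast
  next
    case False
    then obtain v vs1 where vs: "vs = v # vs1" by (cases vs) auto
    have vs1: "sorted_wrt ne_less vs1" "\<forall>c\<in>set vs1. ne_less v c"
      using less.prems(2) unfolding vs by auto
    have v: "\<alpha> < fst v" "snd v \<in> H" "fst v \<le> \<beta>"
      using False vs1(2) less.prems(4) unfolding vs by (force simp: ne_less_def)+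
    have vY: "fst v \<in> Y" using conv[OF less.prems(6,7) v(1,3)] .
    have vs1': "\<forall>c\<in>set vs1. fst v < fst c \<and> snd c \<in> H"
      using vs1(2) less.prems(4) unfolding vs by (simp add: ne_less_def)
    show ?thesis
    \<comment> \<open>The column of \<open>v\<close> is at most \<open>\<beta>\<close>, so
      \<open>v\<close> lies left of all of \<open>us\<close>. If it also lies below them, it can
      start the narrow chain, and the left bound moves from \<open>\<alpha>\<close> to its
      column.\<close>
    proof (cases "\<forall>c\<in>set us. snd v < snd c")
      case True
      have "\<exists>us' vs'. ?concl us vs1 (fst v) \<beta> us' vs'"
        by (rule less.hyps[OF _ less.prems(1) vs1(1) less.prems(3) vs1' v(3) vY less.prems(7)])
           (simp add: vs)
      then obtain us' vs' where IH: "?concl us vs1 (fst v) \<beta> us' vs'"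
        by blast
      have "\<forall>c\<in>set us'. ne_less v c"
        using IH True vs1(2) by (auto simp: ne_less_def)
      then have "?concl us vs \<alpha> \<beta> (v # us') vs'"
        using IH v vY unfolding vs by (auto simp: ne_less_def)
      then show ?thesis by blast
    next
      case False
      then obtain u us1 where us: "us = u # us1" by (cases us) auto
      have us1: "sorted_wrt ne_less us1" "\<forall>c\<in>set us1. ne_less u c"
        using less.prems(1) unfolding us by auto
      have u: "\<beta> < fst u" "fst u \<in> Y" "snd u \<le> snd v"
        using False us1(2) less.prems(3) unfolding us by (force simp: ne_less_def)+
      \<comment> \<open>A row of \<open>us\<close> outside \<open>H\<close> lies above all of
        \<open>H\<close>, hence above the row of \<open>v\<close>. So \<open>u\<close> fits into the
        wide rectangle.\<close>
      have uH: "snd u \<in> H" using less.prems(3) u(3) v(2) unfolding us by force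
      have us1': "\<forall>c\<in>set us1. fst u < fst c \<and> fst c \<in> Y \<and> (snd c \<in> H \<or> (\<forall>h\<in>H. h < snd c))"
        using us1(2) less.prems(3) unfolding us by (simp add: ne_less_def)
      show ?thesis
      proof (cases "snd u < snd v")
        case True
        have "\<exists>us' vs'. ?concl us1 vs \<alpha> (fst u) us' vs'"
          by (rule less.hyps[OF _ us1(1) less.prems(2) us1' less.prems(4) _ less.prems(6) u(2)])
             (use u(1) less.prems(5) in \<open>simp_all add: us\<close>)
        then obtain us' vs' where IH: "?concl us1 vs \<alpha> (fst u) us' vs'"
          by blast
        have "\<forall>c\<in>set vs'. ne_less u c"
          using IH True us1(2) vs1(2) unfolding vs by (fastforce simp: ne_less_def)
        then have "?concl us vs \<alpha> \<beta> us' (u # vs')"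
          using IH u uH unfolding us by (auto simp: ne_less_def)
        then show ?thesis by blast
      next
        case False
        \<comment> \<open>Two cells of one row cannot both start the same chain, so \<open>u\<close>
          and \<open>v\<close> trade places and both bounds move.\<close>
        then have eq: "snd u = snd v" using u(3) by simp
        have "\<exists>us' vs'. ?concl us1 vs1 (fst v) (fst u) us' vs'"
          by (rule less.hyps[OF _ us1(1) vs1(1) us1' vs1' _ vY u(2)])
             (use u(1) v(3) in \<open>simp_all add: us vs\<close>)
        then obtain us' vs' where IH: "?concl us1 vs1 (fst v) (fst u) us' vs'"
          by blast
        have "\<forall>c\<in>set vs'. ne_less u c" "\<forall>c\<in>set us'. ne_less v c"
          using IH eq us1(2) vs1(2) by (auto simp: ne_less_def)
        then have "?concl us vs \<alpha> \<beta> (v # us') (u # vs')"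
          using IH u uH v vY unfolding us vs by (auto simp: ne_less_def)
        then show ?thesis by blast
      qed
    qed
  qed
qed

text \<open>The point reflection \<open>n\<close> reduces this to \<open>exchange_above\<close>: it
  reverses \<open>ne_less\<close>, so reversed lists become chains again, and it turns left into
  right and below into above.\<close>

lemma exchange_below:
  assumes conv: "\<And>a b c. \<lbrakk>a \<in> Y; b \<in> Y; a < c; c \<le> b\<rbrakk> \<Longrightarrow> c \<in> Y"
    and us: "sorted_wrt ne_less us" and vs: "sorted_wrt ne_less vs"
    and usY: "\<forall>c\<in>set us. fst c < \<beta> \<and> fst c \<in> Y \<and> (snd c \<in> H \<or> (\<forall>h\<in>H. snd c < h))"
    and vsH: "\<forall>c\<in>set vs. fst c < \<alpha> \<and> snd c \<in> H"
    and "\<beta> \<le> \<alpha>" and "\<alpha> \<in> Y" and "\<beta> \<in> Y"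
  shows "\<exists>us' vs'. sorted_wrt ne_less us' \<and> sorted_wrt ne_less vs' \<and>
    set us' \<subseteq> set us \<union> set vs \<and> set vs' \<subseteq> set us \<union> set vs \<and>
    length us' + length vs' = length us + length vs \<and>
    (\<forall>c\<in>set us'. fst c < \<alpha> \<and> fst c \<in> Y) \<and> (\<forall>c\<in>set vs'. fst c < \<beta> \<and> snd c \<in> H)"
proof -
  define n :: "cell \<Rightarrow> cell" where "n = (\<lambda>c. (- fst c, - snd c))"
  have nn: "n (n c) = c" "fst (n c) = - fst c" "snd (n c) = - snd c" for c
    by (simp_all add: n_def)
  have less: "ne_less (n c) (n d) \<longleftrightarrow> ne_less d c" for c d
    by (auto simp: n_def ne_less_def)
  have srt: "sorted_wrt ne_less (map n (rev xs))" if "sorted_wrt ne_less xs" for xs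
    using that by (simp add: sorted_wrt_map sorted_wrt_rev less)
  have "\<exists>us' vs'. sorted_wrt ne_less us' \<and> sorted_wrt ne_less vs' \<and>
    set us' \<subseteq> set (map n (rev us)) \<union> set (map n (rev vs)) \<and>
    set vs' \<subseteq> set (map n (rev us)) \<union> set (map n (rev vs)) \<and>
    length us' + length vs' = length (map n (rev us)) + length (map n (rev vs)) \<and>
    (\<forall>c\<in>set us'. - \<alpha> < fst c \<and> fst c \<in> uminus ` Y) \<and>
    (\<forall>c\<in>set vs'. - \<beta> < fst c \<and> snd c \<in> uminus ` H)"
  proof (rule exchange_above[OF _ srt[OF us] srt[OF vs]])
    show "c \<in> uminus ` Y" if "a \<in> uminus ` Y" "b \<in> uminus ` Y" "a < c" "c \<le> b" for a b c
    \<comment> \<open>\<open>conv\<close> is half-open and reflection moves its open end to the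
      other side, so the end point is treated apart.\<close>
    proof (cases "c = b")
      case False
      then have "- c \<in> Y"
        using that conv[of "- b" "- a" "- c"] by auto
      then show ?thesis by force
    qed (use that in simp)
  qed (use usY vsH assms(6-) in \<open>auto simp: nn\<close>)
  then obtain us' vs' where *: "sorted_wrt ne_less us'" "sorted_wrt ne_less vs'"
    "set us' \<subseteq> n ` (set us \<union> set vs)" "set vs' \<subseteq> n ` (set us \<union> set vs)"
    "length us' + length vs' = length us + length vs"
    "\<forall>c\<in>set us'. - \<alpha> < fst c \<and> fst c \<in> uminus ` Y"
    "\<forall>c\<in>set vs'. - \<beta> < fst c \<and> snd c \<in> uminus ` H"
    by (auto simp: image_Un)
  have "n ` set us' \<subseteq> set us \<union> set vs" "n ` set vs' \<subseteq> set us \<union> set vs"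
    using *(3,4) nn(1) by fastforce+
  moreover have "\<forall>c\<in>set (map n (rev us')). fst c < \<alpha> \<and> fst c \<in> Y"
    "\<forall>c\<in>set (map n (rev vs')). fst c < \<beta> \<and> snd c \<in> H"
    using *(6,7) by (auto simp: nn)
  ultimately show ?thesis
    using *(5) srt[OF *(1)] srt[OF *(2)]
    by (intro exI[of _ "map n (rev us')"] exI[of _ "map n (rev vs')"] conjI) simp_all
qed

section \<open>Bijections from equal fibre sizes\<close>

text \<open>Fibres over the same value are in bijection, and the fibres partition \<open>A\<close>
  and \<open>B\<close>, so these bijections can be glued.\<close>

lemma bij_betw_if_card_fibres_eq:
  assumes fin: "finite A" "finite B"
    and card: "\<And>y. card {a \<in> A. g a = y} = card {b \<in> B. h b = y}"
  shows "\<exists>\<phi>. bij_betw \<phi> A B \<and> (\<forall>a\<in>A. h (\<phi> a) = g a)"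
proof -
  have "\<exists>F. bij_betw F {a \<in> A. g a = y} {b \<in> B. h b = y}" for y
    using fin card by (intro finite_same_card_bij) auto
  then obtain F where F: "\<And>y. bij_betw (F y) {a \<in> A. g a = y} {b \<in> B. h b = y}"
    by metis
  let ?\<phi> = "\<lambda>a. F (g a) a"
  have img: "?\<phi> a \<in> B" "h (?\<phi> a) = g a" if "a \<in> A" for a
    using bij_betwE[OF F[of "g a"]] that by auto
  have "inj_on ?\<phi> A"
  proof (rule inj_onI)
    fix a b assume ab: "a \<in> A" "b \<in> A" "?\<phi> a = ?\<phi> b"
    then have "g a = g b" using img by metis
    then show "a = b"
      using ab bij_betw_imp_inj_on[OF F[of "g a"]] by (auto dest: inj_onD)
  qed
  moreover have "b \<in> ?\<phi> ` A" if "b \<in> B" for b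
  proof -
    have "b \<in> F (h b) ` {a \<in> A. g a = h b}"
      using that bij_betw_imp_surj_on[OF F[of "h b"]] by auto
    then obtain a where "a \<in> A" "g a = h b" "b = F (h b) a" by blast
    then have "b = ?\<phi> a" by simp
    then show ?thesis using \<open>a \<in> A\<close> by (rule image_eqI)
  qed
  ultimately show ?thesis
    using img by (intro exI[of _ ?\<phi>]) (auto simp: bij_betw_def)
qed

section \<open>The map between fillings of the two polyominoes\<close>

text \<open>The longer row of \<open>P\<close> is at level \<open>l\<close>, the shorter one at level \<open>r\<close>.\<close>

locale row_swap =
  fixes P Q :: "cell set" and j l r :: int
  assumes fin: "finite P"
    and lr: "l = j \<and> r = j + 1 \<or> l = j + 1 \<and> r = j"
    and Q: "\<And>i t. (i, t) \<in> Q \<longleftrightarrow> (i, Transposition.transpose j (j + 1) t) \<in> P"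
    and sub: "row_cols P r \<subseteq> row_cols P l"
    and conv: "\<And>a b c t. \<lbrakk>a \<in> row_cols P t; b \<in> row_cols P t; a < c; c \<le> b\<rbrakk> \<Longrightarrow> c \<in> row_cols P t"
    and comp: "\<And>s t. row_cols P s \<subseteq> row_cols P t \<or> row_cols P t \<subseteq> row_cols P s"
    and nonexc: "\<And>s t u. \<lbrakk>t \<notin> {j, j + 1}; row_cols P t \<noteq> {}; s < t; t < u;
      row_cols P t \<subset> row_cols P s\<rbrakk> \<Longrightarrow> \<not> row_cols P t \<subset> row_cols P u"
begin

abbreviation cols :: "int \<Rightarrow> int set" where
  "cols \<equiv> row_cols P"

abbreviation flip :: "int \<Rightarrow> int" where
  "flip \<equiv> Transposition.transpose j (j + 1)"

text \<open>The lower piece of a chain after its cells in the two swapped rows are cut out. Only the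
  column range \<open>X\<close> of a rectangle is recorded; as every row used contains
  \<open>X\<close>, pieces with the same \<open>X\<close> fit into one rectangle.\<close>

definition below :: "(cell \<Rightarrow> nat) \<Rightarrow> int set \<Rightarrow> int \<Rightarrow> cell list \<Rightarrow> bool" where
  "below f X x cs \<longleftrightarrow> sorted_wrt ne_less cs \<and>
     (\<forall>c\<in>set cs. f c = 1 \<and> fst c \<in> X \<and> X \<subseteq> cols (snd c) \<and> fst c < x \<and> snd c < j)"

definition above :: "(cell \<Rightarrow> nat) \<Rightarrow> int set \<Rightarrow> int \<Rightarrow> cell list \<Rightarrow> bool" where
  "above f X x cs \<longleftrightarrow> sorted_wrt ne_less cs \<and>
     (\<forall>c\<in>set cs. f c = 1 \<and> fst c \<in> X \<and> X \<subseteq> cols (snd c) \<and> x < fst c \<and> j + 1 < snd c)"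

text \<open>Ranges of entire rows suffice, since the narrowest row of a chain contains all its
  columns. If \<open>ne\<close> is at most \<open>k\<close>, the last inequality is an equality,
  because the two pieces together form a chain.\<close>

definition critical :: "(cell \<Rightarrow> nat) \<Rightarrow> nat \<Rightarrow> int \<Rightarrow> bool" where
  "critical f k x \<longleftrightarrow> (\<exists>t ds us. cols r \<subset> cols t \<and> cols t \<subseteq> cols l \<and>
     below f (cols t) x ds \<and> above f (cols t) x us \<and> k \<le> length ds + length us)"

definition level :: "(cell \<Rightarrow> nat) \<Rightarrow> nat \<Rightarrow> int \<Rightarrow> int \<Rightarrow> int" where
  "level f k i = (if i \<in> cols r \<and> \<not> critical f k i then id else flip)"

definition swap :: "nat \<Rightarrow> (cell \<Rightarrow> nat) \<Rightarrow> cell \<Rightarrow> nat" where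
  "swap k f = restrict (\<lambda>(i, t). f (i, level f k i t)) Q"

lemma in_cols: "i \<in> cols t \<longleftrightarrow> (i, t) \<in> P"
  by (simp add: row_cols_def)

lemma cols_if_short: "\<lbrakk>i \<in> cols r; t \<in> {j, j + 1}\<rbrakk> \<Longrightarrow> i \<in> cols t"
  using lr sub by auto

lemma level_level: "level f k i (level f k i t) = t"
  by (simp add: level_def)

text \<open>A column treated by the identity belongs to the short row, hence to both rows, and there
  the interchange does not alter the set of cells.\<close>

lemma mem_Q_iff_level: "(i, t) \<in> Q \<longleftrightarrow> (i, level f k i t) \<in> P"
proof (cases "t \<in> {j, j + 1}")
  case True
  then have "flip t \<in> {j, j + 1}" by auto
  then show ?thesis
    using True cols_if_short by (auto simp: level_def Q in_cols)
qed (auto simp: level_def Q)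

lemma mem_Q_level_iff: "(i, level f k i t) \<in> Q \<longleftrightarrow> (i, t) \<in> P"
  by (simp add: mem_Q_iff_level[of _ _ f k] level_level)

lemma level_other: "t \<notin> {j, j + 1} \<Longrightarrow> level f k i t = t"
  by (simp add: level_def)

lemma swap_apply: "(i, t) \<in> Q \<Longrightarrow> swap k f (i, t) = f (i, level f k i t)"
  by (simp add: swap_def)

lemma swap_fillings: "f \<in> fillings P \<Longrightarrow> swap k f \<in> fillings Q"
  by (auto simp: fillings_def swap_def mem_Q_iff_level[of _ _ f k] PiE_iff)

lemma column_sum_swap: "column_sum Q (swap k f) i = column_sum P f i"
proof -
  have inj: "inj_on (level f k i) S" for S
    by (metis inj_on_inverseI level_level)
  have "{t. (i, t) \<in> Q \<and> swap k f (i, t) = 1} = level f k i ` {t. (i, t) \<in> P \<and> f (i, t) = 1}"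
    (is "?L = _ ` ?R")
  proof (intro set_eqI iffI)
    fix t assume "t \<in> ?L"
    then have "level f k i t \<in> ?R"
      using swap_apply[of i t k f] mem_Q_iff_level[of i t f k] by auto
    then show "t \<in> level f k i ` ?R"
      by (metis imageI level_level)
  next
    fix t assume "t \<in> level f k i ` ?R"
    then show "t \<in> ?L"
      by (auto simp: swap_apply level_level mem_Q_level_iff)
  qed
  then show ?thesis
    unfolding column_sum_def using card_image[OF inj] by simp
qed

text \<open>The pieces \<open>below\<close> and \<open>above\<close> avoid the two swapped rows.
  Since \<open>swap\<close> leaves all other rows alone, the critical columns can be recovered from
  the image.\<close>

lemma critical_cong:
  assumes "\<And>c. \<lbrakk>c \<in> P; snd c \<notin> {j, j + 1}\<rbrakk> \<Longrightarrow> f c = g c"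
  shows "critical f k x \<longleftrightarrow> critical g k x"
proof -
  have "f c = g c" if "fst c \<in> X" "X \<subseteq> cols (snd c)" "snd c < j \<or> j + 1 < snd c" for c X
    using that in_cols[of "fst c" "snd c"] by (intro assms) auto
  then have "below f X x cs \<longleftrightarrow> below g X x cs" "above f X x cs \<longleftrightarrow> above g X x cs" for X cs
    unfolding below_def above_def by metis+
  then show ?thesis unfolding critical_def by simp
qed

lemma inj_swap: "inj_on (swap k) (fillings P)"
proof (rule inj_onI)
  fix f g assume f: "f \<in> fillings P" and g: "g \<in> fillings P" and eq: "swap k f = swap k g"
  have fg: "f (i, t) = g (i, level g k i (level f k i t))" if "(i, t) \<in> P" for i t
    using that swap_apply[of i "level f k i t" k f] swap_apply[of i "level f k i t" k g] eq
    by (simp add: mem_Q_level_iff level_level)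
  \<comment> \<open>Outside the two levels each image agrees with its source, so \<open>f\<close>
    and \<open>g\<close> coincide there and have the same critical columns.\<close>
  have "f (i, t) = g (i, t)" if "(i, t) \<in> P" "t \<notin> {j, j + 1}" for i t
    using fg[OF that(1)] that(2) by (simp add: level_other)
  then have "level f k i = level g k i" for i
    unfolding level_def using critical_cong[of f g k i] by auto
  then have "f c = g c" if "c \<in> P" for c
    using fg[of "fst c" "snd c"] that by (simp add: level_level)
  then show "f = g"
    using f g unfolding fillings_def by (intro PiE_ext) auto
qed

section \<open>Chains through the swapped rows and critical columns\<close>

text \<open>All cells of the spanned rectangle lie in \<open>P\<close> because each column of the
  chain lies in \<open>X\<close> and each of its rows contains \<open>X\<close>.\<close>

lemma chain_list_insert_one:
  assumes "below f X x ds" "above f X x us" "x \<in> X" "X \<subseteq> cols t" "t \<in> {j, j + 1}" "f (x, t) = 1"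
  shows "chain_list P f (ds @ (x, t) # us)"
proof -
  have "sorted_wrt ne_less (ds @ (x, t) # us)"
    using assms unfolding below_def above_def by (fastforce simp: sorted_wrt_append ne_less_def)
  moreover have "\<forall>c\<in>set (ds @ (x, t) # us). f c = 1 \<and> fst c \<in> X \<and> X \<subseteq> cols (snd c)"
    using assms unfolding below_def above_def by auto
  ultimately show ?thesis
    unfolding chain_list_def in_cols[symmetric] by blast
qed

lemma chain_list_insert_two:
  assumes "below f X x ds" "above f X y us" "x < y" "x \<in> X" "y \<in> X" "X \<subseteq> cols r"
    and "f (x, j) = 1" "f (y, j + 1) = 1"
  shows "chain_list P f (ds @ (x, j) # (y, j + 1) # us)"
proof -
  have "X \<subseteq> cols j" "X \<subseteq> cols (j + 1)"
    using assms(6) cols_if_short by auto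
  then have "\<forall>c\<in>set (ds @ (x, j) # (y, j + 1) # us). f c = 1 \<and> fst c \<in> X \<and> X \<subseteq> cols (snd c)"
    using assms unfolding below_def above_def by auto
  moreover have "sorted_wrt ne_less (ds @ (x, j) # (y, j + 1) # us)"
    using assms(1-3) unfolding below_def above_def by (fastforce simp: sorted_wrt_append ne_less_def)
  ultimately show ?thesis
    unfolding chain_list_def in_cols[symmetric] by blast
qed

text \<open>
  The only use of the absence of further exceptional rows: the rows that contain a fixed row lying
  between the short and the long one in length are, on either side, those closest to the pair.
\<close>

lemma nearer_row_contains:
  assumes "cols t \<subseteq> cols l" "cols r \<subset> cols t" "x \<in> cols u" "u \<notin> {j, j + 1}" "cols t \<subseteq> cols h"
    and "j + 1 < u \<and> u < h \<or> h < u \<and> u < j"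
  shows "cols t \<subseteq> cols u"
proof (rule ccontr)
  assume "\<not> cols t \<subseteq> cols u"
  \<comment> \<open>Such a row would be strictly shorter than the rows \<open>l\<close> and
    \<open>h\<close>, which lie on opposite sides of it, and so would be exceptional.\<close>
  then have "cols u \<subset> cols t" using comp[of u t] by blast
  then have "cols u \<subset> cols l" "cols u \<subset> cols h" using assms by blast+
  moreover have "l < u \<and> u < h \<or> h < u \<and> u < l" using assms(6) lr by auto
  moreover have "cols u \<noteq> {}" using assms(3) by blast
  ultimately show False
    using nonexc[OF assms(4), of l h] nonexc[OF assms(4), of h l] by blast
qed

text \<open>Let \<open>us2\<close> be the upper piece showing that \<open>x\<close> is critical.
  Uncrossing \<open>us\<close> and \<open>us2\<close> gives \<open>us'\<close> right of
  \<open>x\<close> and \<open>vs'\<close> right of \<open>y\<close>. The filled cell in column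
  \<open>x\<close> joins \<open>ds\<close> and \<open>us'\<close> to a chain of \<open>P\<close>, so
  \<open>us'\<close> is not longer than \<open>us\<close>. As the total length is kept,
  \<open>vs'\<close> is not shorter than \<open>us2\<close>, and it shows that \<open>y\<close> is
  critical. The converse uncrosses the lower pieces.\<close>

lemma critical_iff_critical:
  assumes max: "\<And>cs. chain_list P f cs \<Longrightarrow> length cs \<le> k"
    and Y: "below f (cols s) x ds" "above f (cols s) y us" "cols s \<subseteq> cols r"
      "x < y" "x \<in> cols s" "y \<in> cols s" "k \<le> Suc (length ds + length us)"
    and x: "f (x, t) = 1" "t \<in> {j, j + 1}" and y: "f (y, t') = 1" "t' \<in> {j, j + 1}"
  shows "critical f k x \<longleftrightarrow> critical f k y"
proof
  assume "critical f k x"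
  then obtain p ds2 us2 where p: "cols r \<subset> cols p" "cols p \<subseteq> cols l"
    and ds2: "below f (cols p) x ds2" and us2: "above f (cols p) x us2"
    and k: "k \<le> length ds2 + length us2"
    unfolding critical_def by blast
  \<comment> \<open>By \<open>nearer_row_contains\<close>, a row of \<open>us\<close> that does not
    contain the wide range lies beyond all rows in \<open>?H\<close>, as the exchange
    requires.\<close>
  let ?H = "{h. j + 1 < h \<and> cols p \<subseteq> cols h}"
  have "\<exists>us' vs'. sorted_wrt ne_less us' \<and> sorted_wrt ne_less vs' \<and>
    set us' \<subseteq> set us \<union> set us2 \<and> set vs' \<subseteq> set us \<union> set us2 \<and>
    length us' + length vs' = length us + length us2 \<and>
    (\<forall>c\<in>set us'. x < fst c \<and> fst c \<in> cols s) \<and> (\<forall>c\<in>set vs'. y < fst c \<and> snd c \<in> ?H)"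
  proof (rule exchange_above[OF conv])
    show "\<forall>c\<in>set us. y < fst c \<and> fst c \<in> cols s \<and> (snd c \<in> ?H \<or> (\<forall>h\<in>?H. h < snd c))"
    proof (intro ballI conjI)
      fix c assume "c \<in> set us"
      then have c: "y < fst c" "fst c \<in> cols s" "cols s \<subseteq> cols (snd c)" "j + 1 < snd c"
        using Y(2) by (auto simp: above_def)
      then show "y < fst c" "fst c \<in> cols s" by auto
      have u: "x \<in> cols (snd c)" "snd c \<notin> {j, j + 1}"
        using c Y(5) by auto
      show "snd c \<in> ?H \<or> (\<forall>h\<in>?H. h < snd c)"
      proof (rule ccontr)
        assume neg: "\<not> ?thesis"
        then obtain h where h: "cols p \<subseteq> cols h" "\<not> (h < snd c)" "snd c \<noteq> h" by auto
        then have "cols p \<subseteq> cols (snd c)"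
          using c(4) by (intro nearer_row_contains[OF p(2,1) u h(1)]) auto
        then show False using c(4) neg by simp
      qed
    qed
  qed (use Y us2 in \<open>auto simp: above_def\<close>)
  then obtain us' vs' where *: "sorted_wrt ne_less us'" "sorted_wrt ne_less vs'"
    "set us' \<subseteq> set us \<union> set us2" "set vs' \<subseteq> set us \<union> set us2"
    "length us' + length vs' = length us + length us2"
    "\<forall>c\<in>set us'. x < fst c \<and> fst c \<in> cols s" "\<forall>c\<in>set vs'. y < fst c \<and> snd c \<in> ?H"
    by blast
  have src: "f c = 1 \<and> fst c \<in> cols p \<and> cols s \<subseteq> cols (snd c) \<and> j + 1 < snd c"
    if "c \<in> set us \<union> set us2" for c
    using that
  proof
    assume "c \<in> set us"
    then show ?thesis using Y(2,3) p(1) unfolding above_def by blast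
  next
    assume "c \<in> set us2"
    then show ?thesis using us2 Y(3) p(1) unfolding above_def by blast
  qed
  have "above f (cols s) x us'"
    using *(1,6) src[OF subsetD[OF *(3)]] unfolding above_def by simp
  then have "chain_list P f (ds @ (x, t) # us')"
    using Y x cols_if_short by (intro chain_list_insert_one) auto
  then have "Suc (length ds + length us') \<le> k"
    using max by fastforce
  then have "k \<le> length ds2 + length vs'"
    using k *(5) Y(7) by linarith
  moreover have "below f (cols p) y ds2"
    using ds2 Y(4) unfolding below_def by force
  moreover have "above f (cols p) y vs'"
    using *(2,7) src[OF subsetD[OF *(4)]] unfolding above_def by simp
  ultimately show "critical f k y"
    using p unfolding critical_def by blast
next
  assume "critical f k y"
  then obtain p ds2 us2 where p: "cols r \<subset> cols p" "cols p \<subseteq> cols l"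
    and ds2: "below f (cols p) y ds2" and us2: "above f (cols p) y us2"
    and k: "k \<le> length ds2 + length us2"
    unfolding critical_def by blast
  let ?H = "{h. h < j \<and> cols p \<subseteq> cols h}"
  have "\<exists>us' vs'. sorted_wrt ne_less us' \<and> sorted_wrt ne_less vs' \<and>
    set us' \<subseteq> set ds \<union> set ds2 \<and> set vs' \<subseteq> set ds \<union> set ds2 \<and>
    length us' + length vs' = length ds + length ds2 \<and>
    (\<forall>c\<in>set us'. fst c < y \<and> fst c \<in> cols s) \<and> (\<forall>c\<in>set vs'. fst c < x \<and> snd c \<in> ?H)"
  proof (rule exchange_below[OF conv])
    show "\<forall>c\<in>set ds. fst c < x \<and> fst c \<in> cols s \<and> (snd c \<in> ?H \<or> (\<forall>h\<in>?H. snd c < h))"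
    proof (intro ballI conjI)
      fix c assume "c \<in> set ds"
      then have c: "fst c < x" "fst c \<in> cols s" "cols s \<subseteq> cols (snd c)" "snd c < j"
        using Y(1) by (auto simp: below_def)
      then show "fst c < x" "fst c \<in> cols s" by auto
      have u: "x \<in> cols (snd c)" "snd c \<notin> {j, j + 1}"
        using c Y(5) by auto
      show "snd c \<in> ?H \<or> (\<forall>h\<in>?H. snd c < h)"
      proof (rule ccontr)
        assume neg: "\<not> ?thesis"
        then obtain h where h: "cols p \<subseteq> cols h" "\<not> (snd c < h)" "snd c \<noteq> h" by auto
        then have "cols p \<subseteq> cols (snd c)"
          using c(4) by (intro nearer_row_contains[OF p(2,1) u h(1)]) auto
        then show False using c(4) neg by simp
      qed
    qed
  qed (use Y ds2 in \<open>auto simp: below_def\<close>)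
  then obtain us' vs' where *: "sorted_wrt ne_less us'" "sorted_wrt ne_less vs'"
    "set us' \<subseteq> set ds \<union> set ds2" "set vs' \<subseteq> set ds \<union> set ds2"
    "length us' + length vs' = length ds + length ds2"
    "\<forall>c\<in>set us'. fst c < y \<and> fst c \<in> cols s" "\<forall>c\<in>set vs'. fst c < x \<and> snd c \<in> ?H"
    by blast
  have src: "f c = 1 \<and> fst c \<in> cols p \<and> cols s \<subseteq> cols (snd c) \<and> snd c < j"
    if "c \<in> set ds \<union> set ds2" for c
    using that
  proof
    assume "c \<in> set ds"
    then show ?thesis using Y(1,3) p(1) unfolding below_def by blast
  next
    assume "c \<in> set ds2"
    then show ?thesis using ds2 Y(3) p(1) unfolding below_def by blast
  qed
  have "below f (cols s) y us'"
    using *(1,6) src[OF subsetD[OF *(3)]] unfolding below_def by simp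
  then have "chain_list P f (us' @ (y, t') # us)"
    using Y y cols_if_short by (intro chain_list_insert_one) auto
  then have "Suc (length us' + length us) \<le> k"
    using max by fastforce
  then have "k \<le> length vs' + length us2"
    using k *(5) Y(7) by linarith
  moreover have "above f (cols p) x us2"
    using us2 Y(4) unfolding above_def by force
  moreover have "below f (cols p) x vs'"
    using *(2,7) src[OF subsetD[OF *(4)]] unfolding below_def by simp
  ultimately show "critical f k x"
    using p unfolding critical_def by blast
qed

section \<open>The map does not exceed the bound on \<open>ne\<close>\<close>

lemma fin_Q: "finite Q"
proof (rule finite_subset)
  show "Q \<subseteq> (\<lambda>(i, t). (i, flip t)) ` P"
  proof
    fix c assume "c \<in> Q"
    then have "(fst c, flip (snd c)) \<in> P" by (simp flip: Q)
    then show "c \<in> (\<lambda>(i, t). (i, flip t)) ` P"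
      by (rule rev_image_eqI) simp
  qed
qed (use fin in simp)

text \<open>By comparability the narrowest row met by the chain is contained in all the others, and
  it contains every column of the chain. \<open>flip\<close> translates levels of \<open>Q\<close>
  into levels of \<open>P\<close>.\<close>

lemma chain_list_common_row:
  assumes "chain_list Q g cs" "cs \<noteq> []"
  shows "\<exists>s. \<forall>c\<in>set cs. fst c \<in> cols s \<and> cols s \<subseteq> cols (flip (snd c))"
proof -
  have mem: "fst c \<in> cols (flip (snd d))" if "c \<in> set cs" "d \<in> set cs" for c d
  proof -
    have "(fst c, snd d) \<in> Q" using assms(1) that unfolding chain_list_def by blast
    then show ?thesis by (simp add: in_cols Q)
  qed
  have "\<exists>d\<in>set cs. \<forall>c\<in>set cs. cols (flip (snd d)) \<subseteq> cols (flip (snd c))"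
    using assms(2)
  proof (induction cs rule: list_nonempty_induct)
    case (cons x xs)
    then obtain d where d: "d \<in> set xs" "\<forall>c\<in>set xs. cols (flip (snd d)) \<subseteq> cols (flip (snd c))"
      by blast
    show ?case
    proof (cases "cols (flip (snd d)) \<subseteq> cols (flip (snd x))")
      case True
      then show ?thesis using d by auto
    next
      case False
      then have "cols (flip (snd x)) \<subseteq> cols (flip (snd d))" using comp by blast
      then show ?thesis using d by auto
    qed
  qed simp
  then show ?thesis using mem by blast
qed

lemma ne_swap_le:
  assumes f: "f \<in> fillings P" and le: "ne P f \<le> k"
  shows "ne Q (swap k f) \<le> k"
proof -
  have max: "length cs \<le> k" if "chain_list P f cs" for cs
    using that le ne_le_iff[OF fin] by blast
  have "length cs \<le> k" if cs: "chain_list Q (swap k f) cs" for cs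
  proof (rule ccontr)
    assume "\<not> length cs \<le> k"
    then have long: "k < length cs" by simp
    then have "cs \<noteq> []" by auto
    from chain_list_common_row[OF cs this]
    obtain s where s: "\<And>c. c \<in> set cs \<Longrightarrow> fst c \<in> cols s \<and> cols s \<subseteq> cols (flip (snd c))"
      by blast
    have srt: "sorted_wrt ne_less cs" using cs by (simp add: chain_list_def)
    have inQ: "c \<in> Q" if "c \<in> set cs" for c
      using cs that unfolding chain_list_def by (metis prod.collapse)
    have val: "f (x, level f k x t) = 1" if "(x, t) \<in> set cs" for x t
    proof -
      have "swap k f (x, t) = 1" using cs that unfolding chain_list_def by blast
      then show ?thesis using swap_apply[OF inQ[OF that]] by simp
    qed
    have other: "f c = 1 \<and> fst c \<in> cols s \<and> cols s \<subseteq> cols (snd c)"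
      if "c \<in> set cs" "snd c \<notin> {j, j + 1}" for c
      using s[OF that(1)] val[of "fst c" "snd c"] that by (simp add: level_other)
    have critical0: False if "critical f k x" "f (x, l) = 1" "x \<in> cols r" for x
    proof -
      obtain t ds us where t: "cols r \<subset> cols t" "cols t \<subseteq> cols l"
        and *: "below f (cols t) x ds" "above f (cols t) x us" "k \<le> length ds + length us"
        using \<open>critical f k x\<close> unfolding critical_def by blast
      have "chain_list P f (ds @ (x, l) # us)"
        using * t that lr by (intro chain_list_insert_one) auto
      then show False using max * by fastforce
    qed
    have single: False
      if cs_eq: "cs = ds @ (x, t) # us" and t: "t \<in> {j, j + 1}"
        and rest: "\<forall>c\<in>set ds \<union> set us. snd c \<notin> {j, j + 1}" for ds us x t
    proof -
      have srt': "sorted_wrt ne_less ds" "sorted_wrt ne_less us"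
        "\<And>c. c \<in> set ds \<Longrightarrow> fst c < x \<and> snd c < t" "\<And>c. c \<in> set us \<Longrightarrow> x < fst c \<and> t < snd c"
        using srt unfolding cs_eq by (auto simp: sorted_wrt_append ne_less_def)
      have "snd c < j" if "c \<in> set ds" for c
        using srt'(3)[OF that] rest that t by force
      then have ds: "below f (cols s) x ds"
        using srt'(1,3) other rest cs_eq unfolding below_def by simp
      have "j + 1 < snd c" if "c \<in> set us" for c
        using srt'(4)[OF that] rest that t by force
      then have us: "above f (cols s) x us"
        using srt'(2,4) other rest cs_eq unfolding above_def by simp
      have x: "x \<in> cols s" "cols s \<subseteq> cols (flip t)" using s[of "(x, t)"] cs_eq by auto
      have no_insert: False if "cols s \<subseteq> cols t'" "t' \<in> {j, j + 1}" "f (x, t') = 1" for t'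
        using max[OF chain_list_insert_one[OF ds us x(1) that]] long cs_eq by simp
      have fx: "f (x, level f k x t) = 1" using val cs_eq by simp
      show False
      \<comment> \<open>If the range fits into the short row, both levels contain it, and the entry
        can be put back where it came from.\<close>
      proof (cases "cols s \<subseteq> cols r")
        case True
        have "level f k x t \<in> {j, j + 1}" using t by (auto simp: level_def)
        then show False
          using no_insert fx True cols_if_short by blast
      next
        case False
        then have sr: "cols r \<subset> cols s" using comp[of r s] by blast
        \<comment> \<open>A range exceeding the short row forces the chain to use the long row. Its
          remaining cells, at least \<open>k\<close> many, then witness that \<open>x\<close> is
          critical, so the entry was carried along from level \<open>l\<close>.\<close>
        have "flip t \<noteq> r" using False x(2) by auto
        then have t: "t = r" "flip t = l" using t lr by auto
        then have crit: "critical f k x"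
          using sr x(2) ds us long cs_eq unfolding critical_def
          by (intro exI[of _ s] exI[of _ ds] exI[of _ us]) auto
        then have "level f k x t = l" using t by (simp add: level_def)
        then show False
          using no_insert[of l] fx x t lr by auto
      qed
    qed
    have double: False if cs_eq: "cs = ds @ (x, j) # (y, j + 1) # us" for ds us x y
    proof -
      have srt': "sorted_wrt ne_less ds" "sorted_wrt ne_less us"
        "\<And>c. c \<in> set ds \<Longrightarrow> fst c < x \<and> snd c < j" "\<And>c. c \<in> set us \<Longrightarrow> y < fst c \<and> j + 1 < snd c"
        using srt unfolding cs_eq by (auto simp: sorted_wrt_append ne_less_def)
      have ds: "below f (cols s) x ds"
        using srt'(1,3) other cs_eq unfolding below_def by fastforce
      have us: "above f (cols s) y us"
        using srt'(2,4) other cs_eq unfolding above_def by fastforce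
      have xy: "x < y" "x \<in> cols s" "y \<in> cols s" "cols s \<subseteq> cols r"
        using srt s[of "(x, j)"] s[of "(y, j + 1)"] lr unfolding cs_eq
        by (auto simp: sorted_wrt_append ne_less_def)
      have fx: "f (x, level f k x j) = 1" and fy: "f (y, level f k y (j + 1)) = 1"
        using val cs_eq by auto
      have lev: "level f k x j \<in> {j, j + 1}" "level f k y (j + 1) \<in> {j, j + 1}"
        by (auto simp: level_def)
      have len: "k \<le> Suc (length ds + length us)" using long cs_eq by simp
      have iff: "critical f k x \<longleftrightarrow> critical f k y"
        using critical_iff_critical[OF max ds us xy(4,1,2,3) len fx lev(1) fy lev(2)] .
      have xyr: "x \<in> cols r" "y \<in> cols r" using xy by auto
      show False
      proof (cases "critical f k x")
        case True
        \<comment> \<open>Both entries were moved, so one of them came from the long row, where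
          critical columns are empty.\<close>
        then have "f (x, flip j) = 1" "f (y, flip (j + 1)) = 1"
          using fx fy iff by (auto simp: level_def)
        then show False
          using critical0 True iff xyr lr by auto
      next
        case False
        \<comment> \<open>Both entries kept their levels, so the same chain is already present in
          \<open>P\<close>.\<close>
        then have "f (x, j) = 1" "f (y, j + 1) = 1"
          using fx fy iff xyr by (auto simp: level_def)
        then show False
          using max[OF chain_list_insert_two[OF ds us xy]] long cs_eq by simp
      qed
    qed
    show False
    proof (cases "\<exists>c\<in>set cs. snd c \<in> {j, j + 1}")
      case False
      then have "chain_list P f cs"
        using srt other unfolding chain_list_def in_cols[symmetric] by blast
      then show False using max long by fastforce
    next
      case True
      then obtain ds c us where c: "cs = ds @ c # us" "snd c \<in> {j, j + 1}"
        "\<forall>d\<in>set ds. snd d \<notin> {j, j + 1}"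
        using split_list_first_prop[of cs "\<lambda>c. snd c \<in> {j, j + 1}"] by blast
      have us: "ne_less c d" if "d \<in> set us" for d
        using srt c that by (simp add: sorted_wrt_append)
      show False
      proof (cases "\<exists>d\<in>set us. snd d \<in> {j, j + 1}")
        case False
        then show False
          using single[of ds "fst c" "snd c" us] c by auto
      next
        case True
        then obtain d where d: "d \<in> set us" "snd d \<in> {j, j + 1}" by blast
        then have cd: "snd c = j" "snd d = j + 1"
          using us[OF d(1)] c(2) by (auto simp: ne_less_def)
        obtain e vs where e: "us = e # vs" using d by (cases us) auto
        \<comment> \<open>No level lies strictly between \<open>j\<close> and \<open>j + 1\<close>,
          so the two cells in the swapped rows are consecutive in the chain.\<close>
        have "d = e"
        proof (rule ccontr)
          assume "d \<noteq> e"
          then have "ne_less e d" using d e srt c by (auto simp: sorted_wrt_append)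
          then show False using us[of e] e cd by (auto simp: ne_less_def)
        qed
        then show False
          using double[of ds "fst c" "fst e" vs] c e cd by (metis prod.collapse)
      qed
    qed
  qed
  then show ?thesis
    using ne_le_iff[OF fin_Q] by blast
qed

text \<open>\<open>swap k\<close> is injective and respects the bound \<open>k\<close>, which yields
  one inequality; the interchange back from \<open>Q\<close> to \<open>P\<close> will supply the
  other.\<close>

lemma card_fillings_le:
  "card {f \<in> fillings P. column_sum P f = s \<and> ne P f \<le> k} \<le>
   card {g \<in> fillings Q. column_sum Q g = s \<and> ne Q g \<le> k}"
proof (rule card_inj_on_le)
  show "inj_on (swap k) {f \<in> fillings P. column_sum P f = s \<and> ne P f \<le> k}"
    by (rule inj_on_subset[OF inj_swap]) blast
  show "swap k ` {f \<in> fillings P. column_sum P f = s \<and> ne P f \<le> k} \<subseteq>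
      {g \<in> fillings Q. column_sum Q g = s \<and> ne Q g \<le> k}"
  proof (rule image_subsetI)
    fix f assume "f \<in> {f \<in> fillings P. column_sum P f = s \<and> ne P f \<le> k}"
    then have f: "f \<in> fillings P" "column_sum P f = s" "ne P f \<le> k" by blast+
    have "column_sum Q (swap k f) = s"
      by (rule ext) (simp only: column_sum_swap f(2))
    then show "swap k f \<in> {g \<in> fillings Q. column_sum Q g = s \<and> ne Q g \<le> k}"
      using swap_fillings[OF f(1)] ne_swap_le[OF f(1,3)] by blast
  qed
  show "finite {g \<in> fillings Q. column_sum Q g = s \<and> ne Q g \<le> k}"
    using fin_Q by (simp add: fillings_def finite_PiE)
qed

end

section \<open>Almost-moon polyominoes and the final count\<close>

lemma mem_interchange_rows_iff:
  "(i, t) \<in> interchange_rows a b P \<longleftrightarrow> (i, Transposition.transpose a b t) \<in> P"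
proof
  assume "(i, t) \<in> interchange_rows a b P"
  then show "(i, Transposition.transpose a b t) \<in> P"
    by (auto simp: interchange_rows_def)
next
  assume "(i, Transposition.transpose a b t) \<in> P"
  then show "(i, t) \<in> interchange_rows a b P"
    unfolding interchange_rows_def by (rule rev_image_eqI) simp
qed

text \<open>Strict inclusion of finite rows gives a strict inequality of lengths, so a row violating
  the last locale assumption would be exceptional. Empty levels are trivially convex and comparable,
  so these conditions extend to all levels.\<close>

lemma row_swapI:
  assumes P: "almost_moon P"
    and Q: "\<And>i t. (i, t) \<in> Q \<longleftrightarrow> (i, Transposition.transpose j (j + 1) t) \<in> P"
    and exc: "\<forall>t. exceptional_row P t \<longrightarrow> t \<in> {j, j + 1}"
    and lr: "l = j \<and> r = j + 1 \<or> l = j + 1 \<and> r = j"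
    and sub: "row_cols P r \<subseteq> row_cols P l"
  shows "row_swap P Q j l r"
proof
  have finP: "finite P" using P by (simp add: almost_moon_def)
  have fin_cols: "finite (row_cols P t)" for t
  proof (rule finite_subset)
    show "row_cols P t \<subseteq> fst ` P" by (force simp: row_cols_def)
  qed (use finP in simp)
  show "finite P" by fact
  show "c \<in> row_cols P t" if "a \<in> row_cols P t" "b \<in> row_cols P t" "a < c" "c \<le> b" for a b c t
  proof -
    have "{a..b} \<subseteq> row_cols P t"
      using P that(1,2) unfolding almost_moon_def row_convex_def is_row_def by blast
    then show ?thesis using that(3,4) by auto
  qed
  show "row_cols P s \<subseteq> row_cols P t \<or> row_cols P t \<subseteq> row_cols P s" for s t
    using P unfolding almost_moon_def comparable_rows_def is_row_def by blast
  show "\<not> row_cols P t \<subset> row_cols P u"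
    if "t \<notin> {j, j + 1}" "row_cols P t \<noteq> {}" "s < t" "t < u" "row_cols P t \<subset> row_cols P s" for s t u
  proof
    assume tu: "row_cols P t \<subset> row_cols P u"
    have "row_length P t < row_length P u" "row_length P t < row_length P s"
      using tu that(5) fin_cols unfolding row_length_def by (simp_all add: psubset_card_mono)
    moreover have "is_row P t" "is_row P s" "is_row P u"
      using that tu unfolding is_row_def by auto
    ultimately have "exceptional_row P t"
      using that(3,4) unfolding exceptional_row_def by blast
    then show False using exc that(1) by blast
  qed
qed (fact Q lr sub)+

text \<open>A level set is the difference of two nested sublevel sets. The smaller one is empty for
  \<open>k = 0\<close> and otherwise the sublevel set of the predecessor.\<close>

lemma card_level_eq_if_card_le_eq:
  fixes m :: "'a \<Rightarrow> nat" and n :: "'b \<Rightarrow> nat"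
  assumes fin: "finite A" "finite B"
    and le: "\<And>k. card {a \<in> A. m a \<le> k} = card {b \<in> B. n b \<le> k}"
  shows "card {a \<in> A. m a = k} = card {b \<in> B. n b = k}"
proof -
  have *: "card {c \<in> C. p c = k} = card {c \<in> C. p c \<le> k} - card {c \<in> C. p c < k}"
    if "finite C" for C :: "'c set" and p :: "'c \<Rightarrow> nat"
  proof -
    have "{c \<in> C. p c = k} = {c \<in> C. p c \<le> k} - {c \<in> C. p c < k}" by auto
    then show ?thesis using that by (simp add: card_Diff_subset subset_iff)
  qed
  have "card {a \<in> A. m a < k} = card {b \<in> B. n b < k}"
    using le by (cases k) (simp_all add: less_Suc_eq_le)
  then show ?thesis using *[OF fin(1), of m] *[OF fin(2), of n] le[of k] by simp
qed

theorem theorem1: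
  fixes M N :: "cell set" and j :: int
  assumes "almost_moon M" and "almost_moon N"
    and "is_row M j" and "is_row M (j + 1)"
    and "N = interchange_rows j (j + 1) M"
    and "\<forall>l. exceptional_row M l \<longrightarrow> l \<in> {j, j + 1}"
    and "\<forall>l. exceptional_row N l \<longrightarrow> l \<in> {j, j + 1}"
  shows "\<exists>\<phi> \<psi>.
           bij_betw \<phi> (fillings M) (fillings N) \<and>
           (\<forall>f\<in>fillings M. (\<forall>i. column_sum N (\<phi> f) i = column_sum M f i) \<and> ne N (\<phi> f) = ne M f) \<and>
           bij_betw \<psi> (fillings N) (fillings M) \<and>
           (\<forall>g\<in>fillings N. (\<forall>i. column_sum M (\<psi> g) i = column_sum N g i) \<and> ne M (\<psi> g) = ne N g) \<and>
           (\<forall>f\<in>fillings M. \<psi> (\<phi> f) = f)"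
proof -
  let ?flip = "Transposition.transpose j (j + 1)"
  have N: "(i, t) \<in> N \<longleftrightarrow> (i, ?flip t) \<in> M" for i t
    by (simp add: assms(5) mem_interchange_rows_iff)
  have M: "(i, t) \<in> M \<longleftrightarrow> (i, ?flip t) \<in> N" for i t
    by (simp add: N)
  have "row_cols M (j + 1) \<subseteq> row_cols M j \<or> row_cols M j \<subseteq> row_cols M (j + 1)"
    using assms(1,3,4) unfolding almost_moon_def comparable_rows_def by blast
  \<comment> \<open>The interchange puts the longer row at the other level, so \<open>l\<close> and
    \<open>r\<close> trade roles on the way back.\<close>
  then have "\<exists>l r. row_swap M N j l r \<and> row_swap N M j r l"
  proof
    assume sub: "row_cols M (j + 1) \<subseteq> row_cols M j"
    then have "row_cols N j \<subseteq> row_cols N (j + 1)" by (auto simp: row_cols_def N)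
    then show ?thesis
      using sub row_swapI[OF assms(1) N assms(6), of j "j + 1"]
        row_swapI[OF assms(2) M assms(7), of "j + 1" j] by blast
  next
    assume sub: "row_cols M j \<subseteq> row_cols M (j + 1)"
    then have "row_cols N (j + 1) \<subseteq> row_cols N j" by (auto simp: row_cols_def N)
    then show ?thesis
      using sub row_swapI[OF assms(1) N assms(6), of "j + 1" j]
        row_swapI[OF assms(2) M assms(7), of j "j + 1"] by blast
  qed
  then obtain l r where MN: "row_swap M N j l r" and NM: "row_swap N M j r l" by blast
  have fin: "finite (fillings M)" "finite (fillings N)"
    using assms(1,2) by (simp_all add: almost_moon_def fillings_def finite_PiE)
  have le: "card {f \<in> fillings M. column_sum M f = s \<and> ne M f \<le> k} =
      card {g \<in> fillings N. column_sum N g = s \<and> ne N g \<le> k}" for s k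
    by (intro order.antisym row_swap.card_fillings_le[OF MN] row_swap.card_fillings_le[OF NM])
  have "card {f \<in> fillings M. column_sum M f = s \<and> ne M f = k} =
      card {g \<in> fillings N. column_sum N g = s \<and> ne N g = k}" for s k
    using card_level_eq_if_card_le_eq[of "{f \<in> fillings M. column_sum M f = s}"
        "{g \<in> fillings N. column_sum N g = s}" "ne M" "ne N" k] le fin by simp
  \<comment> \<open>Column sums and \<open>ne\<close> form one joint statistic, so a single
    bijection preserves both, and its inverse does so too.\<close>
  then have "card {f \<in> fillings M. (column_sum M f, ne M f) = y} =
      card {g \<in> fillings N. (column_sum N g, ne N g) = y}" for y
    by (cases y) simp
  then obtain \<phi> where \<phi>: "bij_betw \<phi> (fillings M) (fillings N)"
    and pres: "\<forall>f\<in>fillings M. (column_sum N (\<phi> f), ne N (\<phi> f)) = (column_sum M f, ne M f)"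
    using bij_betw_if_card_fibres_eq[OF fin, of "\<lambda>f. (column_sum M f, ne M f)"
        "\<lambda>g. (column_sum N g, ne N g)"] by blast
  let ?\<psi> = "inv_into (fillings M) \<phi>"
  have \<psi>: "bij_betw ?\<psi> (fillings N) (fillings M)"
    using \<phi> by (rule bij_betw_inv_into)
  have "(column_sum M (?\<psi> g), ne M (?\<psi> g)) = (column_sum N g, ne N g)" if "g \<in> fillings N" for g
    using pres that bij_betwE[OF \<psi>] bij_betw_inv_into_right[OF \<phi>] by (metis (no_types, lifting))
  moreover have "\<forall>f\<in>fillings M. ?\<psi> (\<phi> f) = f"
    using bij_betw_inv_into_left[OF \<phi>] by blast
  ultimately show ?thesis
    using \<phi> \<psi> pres by (intro exI[of _ \<phi>] exI[of _ ?\<psi>]) auto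
qed

end
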